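(* Let $P_{(d_w,d_z)}$ be a reducible restrictive polynomial correspondence of bidegree $(d_w,d_z)$ that can be factorised as $P_{(d_w,d_z)}=\left[Q_{(d_w',d_z')}\right]^d$, where $Q_{(d_w',d_z')}$ is an irreducible restrictive polynomial correspondence of bidegree $(d_w',d_z')$ and $d$ is a common divisor of $d_w$ and $d_z$ satisfying $d\,d_w'=d_w$ and $d\,d_z'=d_z$. Then the rank of the matrix $M_{P_{(d_w,d_z)}}$ associated to $P_{(d_w,d_z)}$ is $d+1$.
   Context: Let $d_w,d_z$ be strictly positive integers. A polynomial correspondence of bidegree $(d_w,d_z)$ is a polynomial $P(z,w)=\sum_{j=0}^{d_w}\sum_{k=0}^{d_z}\Lambda_{(j,k)}z^jw^k\in\mathbb{C}[z,w]$ of degree $d_w$ in $z$ and degree $d_z$ in $w$, such that (P1) no linear polynomial in $z$ divides $P$, and (P2) no linear polynomial in $w$ divides $P$. Standing assumption on the correspondence $P$ under study: at least one of $d_w,d_z$ is strictly bigger than $1$ (its factors may have any strictly positive bidegree). Its associated matrix $M_P$ is the $(d_w+1)\times(d_z+1)$ matrix of coefficients whose rows are indexed by $j=d_w,d_w-1,\dots,0$ and columns by $k=d_z,d_z-1,\dots,0$, with entry $\Lambda_{(j,k)}$ in position $(j,k)$. Solutions are taken in $\mathbb{P}^1=\mathbb{C}\cup\{\infty\}$, using the biprojective completion of the zero set of $P$ in $\mathbb{P}^1\times\mathbb{P}^1$, and are counted with multiplicity. For a point $z_0$, $L_w(z_0)=[w^{(1)}(z_0),\dots,w^{(d_z)}(z_0)]$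 is the list (multiset) of the $d_z$ solutions $w$ of $P(z_0,w)=0$; for a point $w_0$, $L_z(w_0)$ is the list (multiset) of the $d_w$ solutions $z$ of $P(z,w_0)=0$. $P$ is called restrictive if for every $z_0\in\mathbb{C}$ the lists $L_z(w^{(1)}(z_0)),\dots,L_z(w^{(d_z)}(z_0))$ all coincide. A restrictive polynomial correspondence is irreducible if it cannot be expressed as a product of finitely many (more than one) restrictive polynomial correspondences, and reducible otherwise. *)

theory Defs
  imports
    Complex_Main
    "HOL-Library.Multiset"
    "HOL-Computational_Algebra.Computational_Algebra"
    "Jordan_Normal_Form.DL_Rank"
begin

text \<open>
  A polynomial \<open>P(z,w)\<close> is an element of \<open>\<complex>[z][w]\<close>, i.e. a polynomial in \<open>w\<close> whose
  coefficients are polynomials in \<open>z\<close>: the coefficient of \<open>z^j w^k\<close> is \<open>coeff (coeff P k) j\<close>.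
  By the convention for bidegrees, \<open>d\<^sub>w\<close> (the number of solutions \<open>z\<close> for given \<open>w\<close>) is the degree
  in \<open>z\<close>, and \<open>d\<^sub>z\<close> is the degree in \<open>w\<close>.
\<close>

definition degree_z :: "complex poly poly \<Rightarrow> nat" where
  "degree_z P = Max ((\<lambda>k. degree (coeff P k)) ` {..degree P})"

definition degree_w :: "complex poly poly \<Rightarrow> nat" where
  "degree_w P = degree P"

definition poly_in_z :: "complex poly \<Rightarrow> complex poly poly" where
  "poly_in_z a = [:a:]"

definition poly_in_w :: "complex poly \<Rightarrow> complex poly poly" where
  "poly_in_w b = map_poly (\<lambda>c. [:c:]) b"

definition polynomial_correspondence :: "nat \<Rightarrow> nat \<Rightarrow> complex poly poly \<Rightarrow> bool" where
  "polynomial_correspondence dw dz P \<longleftrightarrow>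
     dw > 0 \<and> dz > 0 \<and> degree_z P = dw \<and> degree_w P = dz \<and>
     (\<forall>a. degree a = 1 \<longrightarrow> \<not> poly_in_z a dvd P) \<and>
     (\<forall>b. degree b = 1 \<longrightarrow> \<not> poly_in_w b dvd P)"

definition corr_matrix :: "nat \<Rightarrow> nat \<Rightarrow> complex poly poly \<Rightarrow> complex mat" where
  "corr_matrix dw dz P = mat (dw + 1) (dz + 1) (\<lambda>(r, c). coeff (coeff P (dz - c)) (dw - r))"

datatype P1 = Pt complex | Infty

text \<open>
  The biprojective completion is the zero set of the bihomogeneous form
  \<open>\<Sum>j k. \<Lambda>(j,k) z^j z'^(d\<^sub>w - j) w^k w'^(d\<^sub>z - k)\<close>, where \<open>Pt c\<close> is \<open>[c : 1]\<close> and \<open>Infty\<close> is \<open>[1 : 0]\<close>.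
  Fixing one of the two points leaves a binary form in the other one; it is represented by its
  dehomogenisation at \<open>w' = 1\<close> (resp. \<open>z' = 1\<close>). At \<open>z = Infty\<close> only the terms with \<open>j = d\<^sub>w\<close>
  survive, at \<open>w = Infty\<close> only those with \<open>k = d\<^sub>z\<close>.
\<close>

fun fix_z :: "complex poly poly \<Rightarrow> P1 \<Rightarrow> complex poly" where
  "fix_z P (Pt z) = map_poly (\<lambda>p. poly p z) P"
| "fix_z P Infty = map_poly (\<lambda>p. coeff p (degree_z P)) P"

fun fix_w :: "complex poly poly \<Rightarrow> P1 \<Rightarrow> complex poly" where
  "fix_w P (Pt w) = poly P [:w:]"
| "fix_w P Infty = coeff P (degree_w P)"

text \<open>
  The zeros with multiplicity of the binary form of degree \<open>n\<close>
  \<open>\<Sum>i\<le>n. coeff p i * x^i * x'^(n - i)\<close>, for nonzero \<open>p\<close> of degree at most \<open>n\<close>: the point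
  \<open>[1 : 0]\<close> is a zero of multiplicity \<open>n - degree p\<close>. For polynomial correspondences the forms
  below are never zero.
\<close>

definition form_zeros :: "nat \<Rightarrow> complex poly \<Rightarrow> P1 multiset" where
  "form_zeros n p = image_mset Pt (proots p) + replicate_mset (n - degree p) Infty"

definition L_w :: "complex poly poly \<Rightarrow> P1 \<Rightarrow> P1 multiset" where
  "L_w P z = form_zeros (degree_w P) (fix_z P z)"

definition L_z :: "complex poly poly \<Rightarrow> P1 \<Rightarrow> P1 multiset" where
  "L_z P w = form_zeros (degree_z P) (fix_w P w)"

definition restrictive :: "complex poly poly \<Rightarrow> bool" where
  "restrictive P \<longleftrightarrow>
     (\<forall>z\<^sub>0 :: complex. \<forall>w \<in># L_w P (Pt z\<^sub>0). \<forall>w' \<in># L_w P (Pt z\<^sub>0). L_z P w = L_z P w')"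

definition restrictive_correspondence :: "nat \<Rightarrow> nat \<Rightarrow> complex poly poly \<Rightarrow> bool" where
  "restrictive_correspondence dw dz P \<longleftrightarrow> polynomial_correspondence dw dz P \<and> restrictive P"

definition decomposable :: "complex poly poly \<Rightarrow> bool" where
  "decomposable P \<longleftrightarrow>
     (\<exists>Rs. length Rs > 1 \<and> (\<forall>R \<in> set Rs. \<exists>dw dz. restrictive_correspondence dw dz R) \<and>
           P = prod_list Rs)"

definition irreducible_restrictive :: "nat \<Rightarrow> nat \<Rightarrow> complex poly poly \<Rightarrow> bool" where
  "irreducible_restrictive dw dz P \<longleftrightarrow> restrictive_correspondence dw dz P \<and> \<not> decomposable P"

definition reducible_restrictive :: "nat \<Rightarrow> nat \<Rightarrow> complex poly poly \<Rightarrow> bool" where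
  "reducible_restrictive dw dz P \<longleftrightarrow> restrictive_correspondence dw dz P \<and> decomposable P"

end

theory Submission
  imports Defs "HOL-Computational_Algebra.Field_as_Ring"
begin

text \<open>
  Write \<open>p\<^sub>w\<close> for the slice \<open>Q(\<cdot>, w)\<close> and \<open>q\<^sub>z\<close> for the slice \<open>Q(z, \<cdot>)\<close>. The heart of the matter is
  that an irreducible restrictive correspondence separates its variables:
  \<open>Q(z, w) = A(z) C(w) + B(z) D(w)\<close>, with \<open>A\<close>, \<open>B\<close> linearly independent and \<open>C\<close>, \<open>D\<close> linearly
  independent. The binomial theorem then writes the coefficient matrix of \<open>Q\<^sup>d\<close> as a sum of \<open>d + 1\<close>
  matrices of rank one. The rank is not smaller, because \<open>d + 1\<close> slices of \<open>Q\<^sup>d\<close> at points \<open>w\<close> with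
  distinct values of \<open>C(w) / D(w)\<close> are linearly independent and lie in the column space
  (\<open>rank_separated_power\<close>).

  Two steps lead to the separated form. The first shows that \<open>Q\<close> is squarefree. Away from finitely
  many \<open>z\<close>, the multiplicity with which a zero \<open>(z, w)\<close> of a prime factor \<open>F\<close> counts on either slice of
  \<open>Q\<close> is the multiplicity of \<open>F\<close> in \<open>Q\<close> (\<open>generic_orders\<close>). Over a generic \<open>z\<close> every prime factor
  has a zero, and the lists \<open>L\<^sub>z\<close> at these zeros agree, so all prime factors have the same multiplicity
  \<open>e\<close>. Hence \<open>Q = S\<^sup>e\<close>, where \<open>S\<close> is again a restrictive correspondence, and irreducibility
  leaves only \<open>e = 1\<close> (\<open>irreducible_restrictive_squarefree\<close>).

  The second step exploits that generic slices now have simple roots. Take a generic \<open>w\<close> and two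
  roots \<open>z\<close>, \<open>z'\<close> of \<open>p\<^sub>w\<close>. Restrictivity says that \<open>q\<^sub>z\<close> and \<open>q\<^sub>z\<^sub>'\<close> have the same roots, so they
  are proportional. Consequently, for any \<open>w\<^sub>1\<close>, \<open>w\<^sub>2\<close> and any root \<open>z\<close> of \<open>p\<^sub>w\<close>, the polynomial
  \<open>q\<^sub>z(w\<^sub>2) p\<^sub>w\<^sub>1 - q\<^sub>z(w\<^sub>1) p\<^sub>w\<^sub>2\<close> vanishes at all the roots of \<open>p\<^sub>w\<close>, and comparing degrees makes it a
  multiple of \<open>p\<^sub>w\<close>. So all slices \<open>p\<^sub>w\<close> lie in the plane spanned by \<open>p\<^sub>w\<^sub>1\<close> and \<open>p\<^sub>w\<^sub>2\<close>
  (\<open>generic_slice_w_in_span\<close>, \<open>squarefree_restrictive_separates\<close>).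
\<close>

section \<open>Slices of a polynomial in two variables\<close>

lemma complex_root_exists:
  fixes p :: "complex poly"
  assumes "degree p > 0" obtains x where "poly p x = 0"
  using assms fundamental_theorem_of_algebra[of p] constant_degree[of p] by auto

abbreviation slice_z :: "complex poly poly \<Rightarrow> complex \<Rightarrow> complex poly" where
  "slice_z F z \<equiv> map_poly (\<lambda>p. poly p z) F"

abbreviation slice_w :: "complex poly poly \<Rightarrow> complex \<Rightarrow> complex poly" where
  "slice_w F w \<equiv> poly F [:w:]"

lemma poly_slice_z: "poly (slice_z F z) w = poly (slice_w F w) z"
  by (induction F) (simp_all add: map_poly_pCons)

lemma slice_z_mult: "slice_z (F * G) z = slice_z F z * slice_z G z"
  by (rule poly_ext) (simp add: poly_slice_z)

lemma slice_z_power: "slice_z (F ^ n) z = slice_z F z ^ n"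
  by (rule poly_ext) (simp add: poly_slice_z)

lemma pderiv_slice_z: "pderiv (slice_z F z) = slice_z (pderiv F) z"
  by (rule poly_eqI) (simp add: coeff_map_poly coeff_pderiv)

lemma pderiv_slice_w: "pderiv (slice_w F w) = slice_w (map_poly pderiv F) w"
  by (induction F) (simp_all add: map_poly_pCons pderiv_add pderiv_mult pderiv_pCons pderiv_smult)

lemma coeff_slice_w: "coeff (slice_w F w) j = poly (map_poly (\<lambda>p. coeff p j) F) w"
  by (induction F) (simp_all add: map_poly_pCons)

lemma degree_slice_z_le: "degree (slice_z F z) \<le> degree F"
  by (rule degree_le) (simp add: coeff_map_poly coeff_eq_0)

lemma finite_degree_slice_z_drop:
  assumes "F \<noteq> 0"
  shows "finite {z. degree (slice_z F z) \<noteq> degree F}"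
proof -
  have "{z. degree (slice_z F z) \<noteq> degree F} \<subseteq> {z. poly (lead_coeff F) z = 0}"
  proof (intro subsetI CollectI)
    fix z assume "z \<in> {z. degree (slice_z F z) \<noteq> degree F}"
    then have ne: "degree (slice_z F z) < degree F"
      using degree_slice_z_le[of z F] by simp
    then have "coeff (slice_z F z) (degree F) = 0" by (rule coeff_eq_0)
    then show "poly (lead_coeff F) z = 0" by (simp add: coeff_map_poly)
  qed
  moreover have "finite {z. poly (lead_coeff F) z = 0}"
    using assms by (intro poly_roots_finite) simp
  ultimately show ?thesis by (rule finite_subset)
qed

section \<open>The degree in the first variable\<close>

lemma degree_coeff_le_degree_z: "degree (coeff F k) \<le> degree_z F"
proof (cases "k \<le> degree F")
  case True
  then show ?thesis unfolding degree_z_def by (intro Max_ge) auto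
next
  case False
  then show ?thesis by (simp add: coeff_eq_0)
qed

lemma degree_z_attained: obtains k where "degree (coeff F k) = degree_z F"
proof -
  have "degree_z F \<in> (\<lambda>k. degree (coeff F k)) ` {..degree F}"
    unfolding degree_z_def by (intro Max_in) auto
  then show ?thesis using that by auto
qed

lemma degree_slice_w_le: "degree (slice_w F w) \<le> degree_z F"
proof (rule degree_le, intro allI impI)
  fix i assume "degree_z F < i"
  then have "map_poly (\<lambda>p. coeff p i) F = 0"
    by (intro poly_eqI) (auto simp: coeff_map_poly intro!: coeff_eq_0 le_less_trans[OF degree_coeff_le_degree_z])
  then show "coeff (slice_w F w) i = 0" by (simp add: coeff_slice_w)
qed

text \<open>
  The polynomial in the statement collects the terms of top degree in \<open>z\<close>. A slice can drop in
  degree or vanish only at a root of it, so both exceptional sets are finite.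
\<close>

lemma leading_form_nonzero:
  assumes "F \<noteq> 0"
  shows "map_poly (\<lambda>p. coeff p (degree_z F)) F \<noteq> 0"
proof
  assume eq: "map_poly (\<lambda>p. coeff p (degree_z F)) F = 0"
  have z: "coeff (coeff F k) (degree_z F) = 0" for k
    using arg_cong[OF eq, of "\<lambda>p. coeff p k"] by (simp add: coeff_map_poly)
  obtain k where k: "degree (coeff F k) = degree_z F" by (rule degree_z_attained)
  have "coeff F k = 0" using z[of k] unfolding k[symmetric] by simp
  then have "degree_z F = 0" using k by simp
  then have "coeff F j = 0" for j
    using degree_coeff_le_degree_z[of F j] z[of j] by (metis le_zero_eq leading_coeff_0_iff)
  with assms show False by (simp add: poly_eq_iff)
qed

lemma finite_degree_slice_w_drop:
  assumes "F \<noteq> 0"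
  shows "finite {w. degree (slice_w F w) \<noteq> degree_z F}"
proof -
  let ?l = "map_poly (\<lambda>p. coeff p (degree_z F)) F"
  have "{w. degree (slice_w F w) \<noteq> degree_z F} \<subseteq> {w. poly ?l w = 0}"
  proof (intro subsetI CollectI)
    fix w assume "w \<in> {w. degree (slice_w F w) \<noteq> degree_z F}"
    then have "degree (slice_w F w) < degree_z F"
      using degree_slice_w_le[of F w] by simp
    then show "poly ?l w = 0" by (simp add: coeff_slice_w[symmetric] coeff_eq_0)
  qed
  moreover have "finite {w. poly ?l w = 0}"
    by (rule poly_roots_finite[OF leading_form_nonzero[OF assms]])
  ultimately show ?thesis by (rule finite_subset)
qed

lemma finite_slice_w_zero:
  assumes "F \<noteq> 0"
  shows "finite {w. slice_w F w = 0}"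
proof -
  have "{w. slice_w F w = 0} \<subseteq> {w. poly (map_poly (\<lambda>p. coeff p (degree_z F)) F) w = 0}"
    by (auto simp: coeff_slice_w[symmetric])
  moreover have "finite {w. poly (map_poly (\<lambda>p. coeff p (degree_z F)) F) w = 0}"
    by (rule poly_roots_finite[OF leading_form_nonzero[OF assms]])
  ultimately show ?thesis by (rule finite_subset)
qed

lemma finite_avoid:
  fixes A :: "complex set"
  assumes "finite A" obtains w where "w \<notin> A"
  using assms infinite_UNIV_char_0 by (metis ex_new_if_finite)

text \<open>
  For generic \<open>w\<close> the slices of \<open>F\<close>, \<open>G\<close> and \<open>F G\<close> all have the full degree in \<open>z\<close>, so the
  claim is inherited from polynomials in one variable.
\<close>

lemma degree_z_mult:
  assumes "F \<noteq> 0" "G \<noteq> 0"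
  shows "degree_z (F * G) = degree_z F + degree_z G"
proof -
  have FG: "F * G \<noteq> 0" using assms by simp
  have "finite ({w. degree (slice_w F w) \<noteq> degree_z F} \<union> {w. degree (slice_w G w) \<noteq> degree_z G}
      \<union> {w. degree (slice_w (F * G) w) \<noteq> degree_z (F * G)}
      \<union> {w. slice_w F w = 0} \<union> {w. slice_w G w = 0})"
    by (intro finite_UnI finite_degree_slice_w_drop finite_slice_w_zero assms FG)
  then obtain w where "w \<notin> {w. degree (slice_w F w) \<noteq> degree_z F}
      \<union> {w. degree (slice_w G w) \<noteq> degree_z G}
      \<union> {w. degree (slice_w (F * G) w) \<noteq> degree_z (F * G)}
      \<union> {w. slice_w F w = 0} \<union> {w. slice_w G w = 0}"
    by (rule finite_avoid)
  then show ?thesis by (auto simp: degree_mult_eq)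
qed

lemma degree_z_power:
  assumes "F \<noteq> 0"
  shows "degree_z (F ^ n) = n * degree_z F"
proof (induction n)
  case 0
  show ?case by (simp add: degree_z_def)
next
  case (Suc n)
  then show ?case using assms by (simp add: degree_z_mult)
qed

section \<open>Common zeros of coprime polynomials\<close>

text \<open>
  This replaces a resultant. The nonzero combinations of \<open>F\<close> and \<open>G\<close> contain a member \<open>m\<close> of least
  degree in \<open>w\<close>; pseudo-division shows that \<open>m\<close> divides both \<open>F\<close> and \<open>G\<close> up to factors in \<open>z\<close> alone.
  If \<open>m\<close> had positive degree, it would absorb the prime \<open>F\<close>, and \<open>F\<close> would divide \<open>G\<close>.
\<close>

lemma prime_coprime_combination:
  fixes F G :: "complex poly poly"
  assumes F: "prime_elem F" and G: "\<not> F dvd G"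
  obtains a b r where "r \<noteq> 0" "a * F + b * G = [:r:]"
proof -
  define I where "I = {a * F + b * G | a b. a * F + b * G \<noteq> 0}"
  have "F \<noteq> 0" using F by auto
  then have "1 * F + 0 * G \<in> I" unfolding I_def by fastforce
  then obtain m where m: "m \<in> I" and min: "\<And>h. h \<in> I \<Longrightarrow> degree m \<le> degree h"
    using ex_has_least_nat[of "\<lambda>h. h \<in> I" "1 * F + 0 * G" degree] by blast
  from m obtain a b where ab: "m = a * F + b * G" and m0: "m \<noteq> 0" unfolding I_def by blast
  have div: "\<exists>c q. c \<noteq> 0 \<and> [:c:] * (x * F + y * G) = m * q" for x y
  proof -
    let ?h = "x * F + y * G"
    obtain c q where c: "c \<noteq> 0" "Polynomial.smult c ?h = m * q + pseudo_mod ?h m"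
      using pseudo_mod(1)[OF m0] by blast
    have "pseudo_mod ?h m = ([:c:] * x - a * q) * F + ([:c:] * y - b * q) * G"
      using c(2) ab by (simp add: algebra_simps smult_add_right)
    then have "pseudo_mod ?h m \<in> I" if "pseudo_mod ?h m \<noteq> 0"
      using that unfolding I_def mem_Collect_eq by metis
    then have "pseudo_mod ?h m = 0"
      using min pseudo_mod(2)[OF m0, of ?h] by (meson leD)
    with c show ?thesis by auto
  qed
  obtain c q where c: "c \<noteq> 0" "[:c:] * F = m * q" using div[of 1 0] by auto
  obtain c' q' where c': "c' \<noteq> 0" "[:c':] * G = m * q'" using div[of 0 1] by auto
  have Fc: "\<not> F dvd [:k:]" if "k \<noteq> 0" "degree F > 0" for k
    using that by (auto dest!: dvd_imp_degree_le)
  \<comment> \<open>Nothing excludes a prime \<open>F\<close> in \<open>z\<close> alone; then \<open>m\<close> has degree zero as a divisor of \<open>c F\<close>.\<close>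
  have deg: "degree m = 0"
  proof (cases "degree F = 0")
    case True
    then have "degree (m * q) = 0" using c by (metis degree_mult_le add_0 degree_pCons_0 le_zero_eq)
    moreover have "m * q \<noteq> 0" using c \<open>F \<noteq> 0\<close> by (metis mult_eq_0_iff pCons_eq_0_iff)
    ultimately show ?thesis by (auto simp: degree_mult_eq)
  next
    case False
    have "F dvd m * q" using c by (metis dvd_triv_right)
    then consider "F dvd m" | "F dvd q" using F by (auto simp: prime_elem_dvd_mult_iff)
    then show ?thesis
    proof cases
      case 1
      then have "F dvd [:c':] * G" using c'(2) by simp
      then have "F dvd [:c':]" using prime_elem_dvd_multD[OF F] G by blast
      then show ?thesis using Fc[OF c'(1)] False by simp
    next
      case 2
      then obtain k where "q = F * k" by (rule dvdE)
      then have "F * [:c:] = F * (m * k)" using c(2) by (simp add: mult_ac)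
      then have "[:c:] = m * k" using \<open>F \<noteq> 0\<close> by (metis mult_left_cancel)
      then have "degree (m * k) = 0" "m * k \<noteq> 0" using c(1) by (metis degree_pCons_0, metis pCons_eq_0_iff)
      then show ?thesis by (auto simp: degree_mult_eq)
    qed
  qed
  then obtain r where "m = [:r:]" by (rule degree_eq_zeroE)
  moreover have "r \<noteq> 0" using m0 \<open>m = [:r:]\<close> by auto
  ultimately show thesis using that[of r a b] ab by simp
qed

text \<open>
  A combination of \<open>F\<close> and \<open>G\<close> that is free of \<open>w\<close> vanishes at the first coordinate of every common
  zero. Only these coordinates are controlled; that is enough, because a generic \<open>w\<close> avoids the
  finitely many zeros over each exceptional \<open>z\<close>.
\<close>

lemma finite_common_zeros:
  fixes F G :: "complex poly poly"
  assumes "prime_elem F" "\<not> F dvd G"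
  shows "finite {z. \<exists>w. poly (slice_w F w) z = 0 \<and> poly (slice_w G w) z = 0}"
proof -
  obtain a b r where r: "r \<noteq> 0" "a * F + b * G = [:r:]"
    using prime_coprime_combination[OF assms] by blast
  have "poly r z = 0" if "poly (slice_w F w) z = 0" "poly (slice_w G w) z = 0" for z w
  proof -
    have "poly r z = poly (slice_w (a * F + b * G) w) z" unfolding r(2) by simp
    then show ?thesis using that by simp
  qed
  then have "{z. \<exists>w. poly (slice_w F w) z = 0 \<and> poly (slice_w G w) z = 0} \<subseteq> {z. poly r z = 0}"
    by blast
  then show ?thesis using poly_roots_finite[OF r(1)] by (rule finite_subset)
qed


section \<open>Multiplicities of zeros on slices\<close>

lemma prime_not_dvd_pderiv:
  fixes F :: "complex poly poly"
  assumes "degree F > 0"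
  shows "\<not> F dvd pderiv F"
proof
  assume dvd: "F dvd pderiv F"
  have "pderiv F \<noteq> 0" using assms by (simp add: pderiv_eq_0_iff)
  with dvd have "degree F \<le> degree (pderiv F)" by (rule dvd_imp_degree_le)
  then show False using assms by (simp add: degree_pderiv)
qed

text \<open>
  The polynomial \<open>map_poly pderiv F\<close> is the partial derivative with respect to \<open>z\<close>. Since its degree
  in \<open>w\<close> does not exceed that of \<open>F\<close>, a cofactor would depend on \<open>z\<close> only, and then some coefficient
  of \<open>F\<close> would divide its own nonzero derivative.
\<close>

lemma not_dvd_pderiv_coeffs:
  fixes F :: "complex poly poly"
  assumes nz: "map_poly pderiv F \<noteq> 0"
  shows "\<not> F dvd map_poly pderiv F"
proof
  assume "F dvd map_poly pderiv F"
  then obtain H where H: "map_poly pderiv F = F * H" by (rule dvdE)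
  with nz have "F \<noteq> 0" "H \<noteq> 0" by auto
  moreover have "degree (map_poly pderiv F) \<le> degree F"
    by (rule degree_le) (simp add: coeff_map_poly coeff_eq_0)
  ultimately have "degree H = 0" by (simp add: H degree_mult_eq)
  then obtain h where h: "H = [:h:]" by (rule degree_eq_zeroE)
  obtain k where "coeff (map_poly pderiv F) k \<noteq> 0"
    using nz by (auto simp: poly_eq_iff)
  then have k: "pderiv (coeff F k) \<noteq> 0" by (simp add: coeff_map_poly)
  have "pderiv (coeff F k) = h * coeff F k"
    using arg_cong[OF H, of "\<lambda>p. coeff p k"] by (simp add: coeff_map_poly h)
  then have "coeff F k dvd pderiv (coeff F k)" by simp
  then have "degree (coeff F k) \<le> degree (pderiv (coeff F k))"
    using k by (rule dvd_imp_degree_le)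
  moreover have "degree (coeff F k) \<noteq> 0" using k by (simp add: pderiv_eq_0_iff)
  ultimately show False by (simp add: degree_pderiv)
qed

lemma order_simple_root:
  fixes p :: "complex poly"
  assumes "poly p x = 0" "poly (pderiv p) x \<noteq> 0"
  shows "Polynomial.order x p = 1"
proof -
  have "p \<noteq> 0" using assms(2) by auto
  then show ?thesis using assms order_pderiv[of p x] by (simp add: order_root)
qed

lemma order_power_mult:
  fixes p q :: "complex poly"
  assumes "Polynomial.order x p = 1" "p \<noteq> 0" "poly q x \<noteq> 0"
  shows "Polynomial.order x (p ^ n * q) = n"
proof -
  have "q \<noteq> 0" using assms(3) by auto
  have "Polynomial.order x (p ^ n) = n"
    by (induction n) (use assms in \<open>simp_all add: order_mult\<close>)
  moreover have "Polynomial.order x q = 0" using assms(3) by (simp add: order_root)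
  ultimately show ?thesis using assms(2) \<open>q \<noteq> 0\<close> by (simp add: order_mult)
qed

text \<open>
  Split \<open>Q = F\<^sup>e G\<close> with \<open>G\<close> prime to \<open>F\<close>. For all but finitely many \<open>z\<close>, neither \<open>G\<close> nor one of the
  two partial derivatives of \<open>F\<close> vanishes at a zero of \<open>F\<close> over \<open>z\<close>, so both slices of \<open>F\<close> have a
  simple root there and \<open>G\<close> contributes nothing.
\<close>

lemma generic_orders_prime_factor:
  fixes F Q :: "complex poly poly"
  assumes F: "prime_elem F" "degree F > 0" "map_poly pderiv F \<noteq> 0" and Q: "Q \<noteq> 0"
  obtains E where "finite E"
    and "\<And>z w. z \<notin> E \<Longrightarrow> poly (slice_w F w) z = 0 \<Longrightarrow>
           Polynomial.order z (slice_w Q w) = multiplicity F Q \<and> Polynomial.order w (slice_z Q z) = multiplicity F Q"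
proof -
  let ?Z = "\<lambda>G. {z. \<exists>w. poly (slice_w F w) z = 0 \<and> poly (slice_w G w) z = 0}"
  define e where "e = multiplicity F Q"
  have "\<not> is_unit F" using F(1) by (simp add: prime_elem_not_unit)
  then obtain G where G: "Q = F ^ e * G" "\<not> F dvd G"
    using multiplicity_decompose'[OF Q] unfolding e_def by blast
  define E where "E = ?Z G \<union> ?Z (pderiv F) \<union> ?Z (map_poly pderiv F)"
  show thesis
  proof (rule that[of E])
    show "finite E"
      unfolding E_def using F G(2)
      by (intro finite_UnI finite_common_zeros prime_not_dvd_pderiv not_dvd_pderiv_coeffs)
  next
    fix z w assume z: "z \<notin> E" and zero: "poly (slice_w F w) z = 0"
    then have nG: "poly (slice_w G w) z \<noteq> 0"
      and nw: "poly (slice_w (pderiv F) w) z \<noteq> 0"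
      and nz: "poly (slice_w (map_poly pderiv F) w) z \<noteq> 0"
      unfolding E_def by blast+
    have "poly (pderiv (slice_w F w)) z \<noteq> 0" using nz by (simp add: pderiv_slice_w)
    then have 1: "Polynomial.order z (slice_w F w) = 1" "slice_w F w \<noteq> 0"
      using order_simple_root[OF zero] by auto
    have "poly (pderiv (slice_z F z)) w \<noteq> 0" using nw by (simp add: pderiv_slice_z poly_slice_z)
    then have 2: "Polynomial.order w (slice_z F z) = 1" "slice_z F z \<noteq> 0"
      using order_simple_root[of "slice_z F z" w] zero by (auto simp: poly_slice_z)
    show "Polynomial.order z (slice_w Q w) = multiplicity F Q \<and> Polynomial.order w (slice_z Q z) = multiplicity F Q"
      using order_power_mult[OF 1 nG, of e] order_power_mult[OF 2, of "slice_z G z" e] nG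
      by (simp add: G(1)[symmetric] poly_slice_z e_def[symmetric])
        (simp add: G(1) slice_z_mult slice_z_power)
  qed
qed

section \<open>Polynomial correspondences\<close>

text \<open>
  The conditions on linear divisors are used only in this form: no slice vanishes identically,
  because the linear polynomials in \<open>z\<close> (in \<open>w\<close>) dividing \<open>Q\<close> correspond to the points over which it
  does.
\<close>

lemma polynomial_correspondence_slices:
  assumes "polynomial_correspondence dw dz Q"
  shows "degree_z Q = dw" "degree Q = dz" "dw > 0" "dz > 0"
    "\<And>z. slice_z Q z \<noteq> 0" "\<And>w. slice_w Q w \<noteq> 0" "Q \<noteq> 0"
proof -
  note c = assms[unfolded polynomial_correspondence_def degree_w_def]
  show "degree_z Q = dw" "degree Q = dz" "dw > 0" "dz > 0" using c by auto
  then show "Q \<noteq> 0" by auto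
  show "slice_z Q z \<noteq> 0" for z
  proof
    assume 0: "slice_z Q z = 0"
    have "poly (coeff Q k) z = 0" for k
      using arg_cong[OF 0, of "\<lambda>p. coeff p k"] by (simp add: coeff_map_poly)
    then have "poly_in_z [:-z, 1:] dvd Q"
      by (simp add: poly_in_z_def const_poly_dvd_iff poly_eq_0_iff_dvd)
    moreover have "degree [:-z, 1:] = 1" by simp
    ultimately show False using c by blast
  qed
  show "slice_w Q w \<noteq> 0" for w
  proof
    assume "slice_w Q w = 0"
    then have "poly_in_w [:-w, 1:] dvd Q"
      by (simp add: poly_in_w_def map_poly_pCons poly_eq_0_iff_dvd one_pCons)
    moreover have "degree [:-w, 1:] = 1" by simp
    ultimately show False using c by blast
  qed
qed

lemma poly_in_w_linear_dvd:
  assumes "degree b = 1" "poly_in_w b dvd Q"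
  obtains r where "slice_w Q r = 0"
proof -
  obtain r where r: "poly b r = 0"
    using assms(1) complex_root_exists[of b] by auto
  have "slice_w (poly_in_w b) r = [:poly b r:]"
    unfolding poly_in_w_def by (induction b) (simp_all add: map_poly_pCons)
  with r assms(2) show thesis by (auto elim!: dvdE intro!: that)
qed

lemma poly_in_z_linear_dvd:
  assumes "degree a = 1" "poly_in_z a dvd Q"
  obtains r where "slice_z Q r = 0"
proof -
  obtain r where r: "poly a r = 0"
    using assms(1) complex_root_exists[of a] by auto
  have "slice_z (poly_in_z a) r = 0"
    unfolding poly_in_z_def using r by (simp add: map_poly_pCons)
  with assms(2) show thesis by (auto elim!: dvdE intro!: that simp: slice_z_mult)
qed

lemma polynomial_correspondenceI:
  assumes "degree_z Q > 0" "degree Q > 0" "\<And>z. slice_z Q z \<noteq> 0" "\<And>w. slice_w Q w \<noteq> 0"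
  shows "polynomial_correspondence (degree_z Q) (degree Q) Q"
  unfolding polynomial_correspondence_def degree_w_def
  using assms poly_in_w_linear_dvd[of _ Q] poly_in_z_linear_dvd[of _ Q] by metis

text \<open>
  A prime factor in \<open>z\<close> alone or in \<open>w\<close> alone is not constant, so it has a root, and the slice of \<open>Q\<close>
  there would be zero.
\<close>

lemma prime_factor_genuinely_bivariate:
  assumes Q: "polynomial_correspondence dw dz Q" and F: "prime_elem F" "F dvd Q"
  shows "degree F > 0" "map_poly pderiv F \<noteq> 0"
proof -
  note Q = polynomial_correspondence_slices[OF Q]
  have nz: "slice_z F z \<noteq> 0" for z using Q(5)[of z] F(2) by (auto elim!: dvdE simp: slice_z_mult)
  have nw: "slice_w F w \<noteq> 0" for w using Q(6)[of w] F(2) by (auto elim!: dvdE)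
  have nu: "\<not> is_unit F" "F \<noteq> 0" using F(1) by (auto simp: prime_elem_not_unit)
  show deg: "degree F > 0"
  proof (rule ccontr)
    assume "\<not> degree F > 0"
    then obtain f where f: "F = [:f:]" by (auto elim: degree_eq_zeroE)
    have "degree f \<noteq> 0" using nu f by (auto simp: is_unit_const_poly_iff is_unit_iff_degree)
    then obtain r where "poly f r = 0"
      using complex_root_exists[of f] by auto
    then show False using nz[of r] f by (simp add: map_poly_pCons)
  qed
  show "map_poly pderiv F \<noteq> 0"
  proof
    assume 0: "map_poly pderiv F = 0"
    have "pderiv (coeff F k) = 0" for k
      using arg_cong[OF 0, of "\<lambda>p. coeff p k"] by (simp add: coeff_map_poly)
    then have const: "degree (coeff F k) = 0" for k by (simp add: pderiv_eq_0_iff)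
    have pc: "poly (coeff F k) z = coeff (coeff F k) 0" for k z
      using const[of k] by (auto elim!: degree_eq_zeroE)
    have "lead_coeff F \<noteq> 0" using nu by simp
    then have "poly (lead_coeff F) 0 \<noteq> 0"
      using const[of "degree F"] by (auto elim!: degree_eq_zeroE)
    then have "coeff (slice_z F 0) (degree F) \<noteq> 0" by (simp add: coeff_map_poly)
    then have "degree (slice_z F 0) \<noteq> 0" using deg le_degree[of "slice_z F 0" "degree F"] by simp
    then obtain r where r: "poly (slice_z F 0) r = 0"
      using complex_root_exists[of "slice_z F 0"] by auto
    have "slice_z F z = slice_z F 0" for z
      by (rule poly_eqI) (simp add: coeff_map_poly pc)
    then have "poly (slice_w F r) z = 0" for z using r by (metis poly_slice_z)
    then have "slice_w F r = 0" by (intro poly_ext) simp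
    with nw show False by blast
  qed
qed


section \<open>Powers of restrictive correspondences\<close>

lemma image_mset_repeat_mset: "image_mset f (repeat_mset n A) = repeat_mset n (image_mset f A)"
  by (induction n) simp_all

lemma form_zeros_power:
  assumes "p \<noteq> 0"
  shows "form_zeros (e * n) (p ^ e) = repeat_mset e (form_zeros n p)"
proof -
  have "replicate_mset (e * n - e * degree p) Infty = repeat_mset e (replicate_mset (n - degree p) Infty)"
    by (simp add: diff_mult_distrib2 multiset_eq_iff)
  then show ?thesis
    using assms by (simp add: form_zeros_def proots_power degree_power_eq image_mset_repeat_mset)
qed

lemma L_w_power:
  assumes "S \<noteq> 0" "slice_z S z \<noteq> 0"
  shows "L_w (S ^ e) (Pt z) = repeat_mset e (L_w S (Pt z))"
  using assms by (simp add: L_w_def degree_w_def slice_z_power degree_power_eq form_zeros_power)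

lemma L_z_power:
  assumes "S \<noteq> 0" "\<And>w. slice_w S w \<noteq> 0"
  shows "L_z (S ^ e) w = repeat_mset e (L_z S w)"
proof -
  have "fix_w (S ^ e) w = fix_w S w ^ e"
    by (cases w) (simp_all add: degree_w_def lead_coeff_power)
  moreover have "fix_w S w \<noteq> 0"
    using assms by (cases w) (simp_all add: degree_w_def)
  ultimately show ?thesis using assms by (simp add: L_z_def degree_z_power form_zeros_power)
qed

text \<open>
  Passing from \<open>S\<close> to \<open>S\<^sup>e\<close> repeats every entry of each list \<open>e\<close> times, also at infinity. This neither
  changes membership nor identifies different lists.
\<close>

lemma restrictive_power_imp:
  assumes "restrictive (S ^ e)" "e > 0" "S \<noteq> 0" "\<And>z. slice_z S z \<noteq> 0" "\<And>w. slice_w S w \<noteq> 0"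
  shows "restrictive S"
  unfolding restrictive_def
proof (intro allI ballI)
  fix z w w' assume "w \<in># L_w S (Pt z)" "w' \<in># L_w S (Pt z)"
  then have "w \<in># L_w (S ^ e) (Pt z)" "w' \<in># L_w (S ^ e) (Pt z)"
    using assms by (simp_all add: L_w_power flip: count_greater_zero_iff)
  then have "L_z (S ^ e) w = L_z (S ^ e) w'" using assms(1) unfolding restrictive_def by blast
  then show "L_z S w = L_z S w'" using assms by (simp add: L_z_power repeat_mset_cancel1)
qed

section \<open>An indecomposable restrictive correspondence is squarefree\<close>

lemma in_L_w_iff:
  assumes "slice_z Q z \<noteq> 0"
  shows "Pt w \<in># L_w Q (Pt z) \<longleftrightarrow> poly (slice_w Q w) z = 0"
  using assms by (auto simp: L_w_def form_zeros_def poly_slice_z[symmetric])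

lemma count_L_z:
  assumes "slice_w Q w \<noteq> 0"
  shows "count (L_z Q (Pt w)) (Pt z) = Polynomial.order z (slice_w Q w)"
proof -
  have "count (image_mset Pt A) (Pt z) = count A z" for A
    by (induction A) simp_all
  then show ?thesis using assms by (simp add: L_z_def form_zeros_def)
qed

text \<open>
  The arguments at generic points read restrictivity off the finite entries of the lists, whose
  multiplicities are orders of roots of slices.
\<close>

lemma restrictive_order_eq:
  assumes Q: "restrictive_correspondence dw dz Q"
    and "poly (slice_w Q w) z = 0" "poly (slice_w Q w') z = 0"
  shows "Polynomial.order x (slice_w Q w) = Polynomial.order x (slice_w Q w')"
proof -
  note pc = polynomial_correspondence_slices[OF conjunct1[OF Q[unfolded restrictive_correspondence_def]]]
  have "Pt w \<in># L_w Q (Pt z)" "Pt w' \<in># L_w Q (Pt z)"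
    using assms pc by (simp_all add: in_L_w_iff)
  then have "L_z Q (Pt w) = L_z Q (Pt w')"
    using Q unfolding restrictive_correspondence_def restrictive_def by blast
  then show ?thesis using count_L_z[OF pc(6)] by metis
qed

lemma generic_orders:
  assumes Q: "polynomial_correspondence dw dz Q"
  obtains E where "finite E"
    and "\<And>F z w. F \<in> prime_factors Q \<Longrightarrow> z \<notin> E \<Longrightarrow> poly (slice_w F w) z = 0 \<Longrightarrow>
           Polynomial.order z (slice_w Q w) = multiplicity F Q \<and>
           Polynomial.order w (slice_z Q z) = multiplicity F Q"
proof -
  have "\<exists>E. finite E \<and> (\<forall>z w. z \<notin> E \<longrightarrow> poly (slice_w F w) z = 0 \<longrightarrow>
           Polynomial.order z (slice_w Q w) = multiplicity F Q \<and>
           Polynomial.order w (slice_z Q z) = multiplicity F Q)" if "F \<in> prime_factors Q" for F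
  proof -
    have F: "prime_elem F" "F dvd Q" using that by (auto simp: in_prime_factors_iff)
    show ?thesis
      using generic_orders_prime_factor[OF F(1) prime_factor_genuinely_bivariate[OF Q F]
          polynomial_correspondence_slices(7)[OF Q]] by metis
  qed
  then obtain E where E: "\<And>F. F \<in> prime_factors Q \<Longrightarrow> finite (E F)"
    "\<And>F z w. F \<in> prime_factors Q \<Longrightarrow> z \<notin> E F \<Longrightarrow> poly (slice_w F w) z = 0 \<Longrightarrow>
           Polynomial.order z (slice_w Q w) = multiplicity F Q \<and>
           Polynomial.order w (slice_z Q z) = multiplicity F Q"
    by metis
  show thesis
    by (rule that[of "\<Union>F\<in>prime_factors Q. E F"]) (use E in auto)
qed

text \<open>
  Over a generic \<open>z\<close> both prime factors have zeros \<open>(z, u)\<close> and \<open>(z, v)\<close>. The multiplicities of \<open>z\<close> in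
  the lists of \<open>u\<close> and \<open>v\<close> are the multiplicities of \<open>F\<close> and \<open>G\<close>, and restrictivity equates the lists.
\<close>

lemma restrictive_multiplicities_equal:
  assumes Q: "restrictive_correspondence dw dz Q"
    and F: "F \<in> prime_factors Q" and G: "G \<in> prime_factors Q"
  shows "multiplicity F Q = multiplicity G Q"
proof -
  have pc: "polynomial_correspondence dw dz Q"
    using Q by (simp add: restrictive_correspondence_def)
  obtain E where E: "finite E" "\<And>F z w. F \<in> prime_factors Q \<Longrightarrow> z \<notin> E \<Longrightarrow> poly (slice_w F w) z = 0 \<Longrightarrow>
           Polynomial.order z (slice_w Q w) = multiplicity F Q \<and>
           Polynomial.order w (slice_z Q z) = multiplicity F Q"
    using generic_orders[OF pc] by metis
  have FG: "degree F > 0" "degree G > 0" "F \<noteq> 0" "G \<noteq> 0" "F dvd Q" "G dvd Q"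
    using F G prime_factor_genuinely_bivariate(1)[OF pc] by (auto simp: in_prime_factors_iff)
  have "finite (E \<union> {z. degree (slice_z F z) \<noteq> degree F} \<union> {z. degree (slice_z G z) \<noteq> degree G})"
    using E(1) FG by (intro finite_UnI finite_degree_slice_z_drop)
  then obtain z where z: "z \<notin> E \<union> {z. degree (slice_z F z) \<noteq> degree F} \<union> {z. degree (slice_z G z) \<noteq> degree G}"
    by (rule finite_avoid)
  have "degree (slice_z F z) > 0" "degree (slice_z G z) > 0" using z FG by auto
  then obtain u v where "poly (slice_z F z) u = 0" "poly (slice_z G z) v = 0"
    by (meson complex_root_exists)
  then have uv: "poly (slice_w F u) z = 0" "poly (slice_w G v) z = 0"
    by (simp_all add: poly_slice_z)
  have "poly (slice_w Q u) z = 0" using uv(1) FG(5) by (auto elim!: dvdE)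
  moreover have "poly (slice_w Q v) z = 0" using uv(2) FG(6) by (auto elim!: dvdE)
  ultimately have "Polynomial.order z (slice_w Q u) = Polynomial.order z (slice_w Q v)"
    by (rule restrictive_order_eq[OF Q])
  then show ?thesis
    using E(2)[OF F _ uv(1)] E(2)[OF G _ uv(2)] z by simp
qed

lemma prime_factorization_up_to_constant:
  fixes Q :: "complex poly poly"
  assumes "Q \<noteq> 0"
  obtains u :: complex where "u \<noteq> 0" "Q = [:[:u:]:] * prod_mset (prime_factorization Q)"
proof -
  let ?R = "prod_mset (prime_factorization Q)"
  have "normalize Q = normalize ?R" using prod_mset_prime_factorization_weak[OF assms] by simp
  then have "Q dvd ?R" "?R dvd Q" by (simp_all add: associated_iff_dvd)
  then obtain k l where kl: "?R = Q * k" "Q = ?R * l" by (metis dvdE)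
  then have "Q * (k * l) = Q * 1" by (metis mult.assoc mult_1_right)
  then have "k * l = 1" using assms by (metis mult_left_cancel)
  then have "is_unit l" by (metis dvd_triv_right)
  then obtain u where u: "l = [:[:u:]:]" "is_unit u" by (auto simp: is_unit_poly_iff)
  then have "u \<noteq> 0" by auto
  then show thesis by (rule that) (use kl(2) u(1) in \<open>simp only: mult.commute\<close>)
qed

text \<open>
  The constant in front of the prime factorisation has an \<open>e\<close>-th root in \<open>\<complex>\<close>, so it can be absorbed
  into the base.
\<close>

lemma equal_multiplicities_imp_power:
  fixes Q :: "complex poly poly"
  assumes "Q \<noteq> 0" "e > 0" and eq: "\<And>F. F \<in> prime_factors Q \<Longrightarrow> multiplicity F Q = e"
  obtains S where "Q = S ^ e"
proof -
  let ?R = "\<Prod>F\<in>prime_factors Q. F"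
  have "prod_mset (prime_factorization Q) = (\<Prod>F\<in>prime_factors Q. F ^ count (prime_factorization Q) F)"
    by (rule prod_mset_multiplicity)
  also have "\<dots> = (\<Prod>F\<in>prime_factors Q. F ^ e)"
    by (intro prod.cong refl) (use eq in \<open>auto simp: count_prime_factorization_prime in_prime_factors_iff\<close>)
  also have "\<dots> = ?R ^ e" by (rule prod_power_distrib[symmetric])
  finally have R: "prod_mset (prime_factorization Q) = ?R ^ e" .
  obtain u where u: "Q = [:[:u:]:] * prod_mset (prime_factorization Q)"
    using prime_factorization_up_to_constant[OF assms(1)] .
  obtain a :: complex where a: "a ^ e = u" using nth_root_exists[OF assms(2), of u] by blast
  have "Q = ([:[:a:]:] * ?R) ^ e"
    by (subst u) (simp only: R a[symmetric] power_mult_distrib poly_const_pow)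
  then show thesis by (rule that)
qed

lemma irreducible_restrictive_squarefree:
  assumes Q: "irreducible_restrictive dw dz Q" and F: "F \<in> prime_factors Q"
  shows "multiplicity F Q = 1"
proof -
  have rc: "restrictive_correspondence dw dz Q" and nd: "\<not> decomposable Q"
    using Q by (simp_all add: irreducible_restrictive_def)
  have pc: "polynomial_correspondence dw dz Q" and rQ: "restrictive Q"
    using rc by (simp_all add: restrictive_correspondence_def)
  note sl = polynomial_correspondence_slices[OF pc]
  define e where "e = multiplicity F Q"
  have e0: "e > 0" unfolding e_def using F sl(7)
    by (auto simp: in_prime_factors_iff prime_multiplicity_gt_zero_iff)
  have "\<And>G. G \<in> prime_factors Q \<Longrightarrow> multiplicity G Q = e"
    unfolding e_def by (rule restrictive_multiplicities_equal[OF rc _ F])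
  then obtain S where S: "Q = S ^ e" using equal_multiplicities_imp_power[OF sl(7) e0] by metis
  have S0: "S \<noteq> 0" using S sl(7) e0 by auto
  have Sz: "slice_z S z \<noteq> 0" for z using sl(5)[of z] e0 by (simp add: S slice_z_power)
  have Sw: "slice_w S w \<noteq> 0" for w using sl(6)[of w] e0 by (simp add: S)
  have "degree_z S > 0" using sl(1,3) S0 by (auto simp: S degree_z_power intro: Nat.gr0I)
  moreover have "degree S > 0" using sl(2,4) S0 by (auto simp: S degree_power_eq intro: Nat.gr0I)
  ultimately have "polynomial_correspondence (degree_z S) (degree S) S"
    using Sz Sw by (rule polynomial_correspondenceI)
  moreover have "restrictive S"
    by (rule restrictive_power_imp[of S e]) (use rQ S e0 S0 Sz Sw in auto)
  ultimately have "restrictive_correspondence (degree_z S) (degree S) S"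
    by (simp add: restrictive_correspondence_def)
  then have "e > 1 \<Longrightarrow> decomposable Q"
    unfolding decomposable_def by (intro exI[of _ "replicate e S"]) (auto simp: S)
  with nd e0 show ?thesis unfolding e_def by linarith
qed


section \<open>Squarefree restrictive correspondences separate the variables\<close>

definition independent_pair :: "complex poly \<Rightarrow> complex poly \<Rightarrow> bool" where
  "independent_pair A B \<longleftrightarrow>
     (\<forall>a b. Polynomial.smult a A + Polynomial.smult b B = 0 \<longrightarrow> a = 0 \<and> b = 0)"

lemma zero_imp_prime_factor_zero:
  assumes "Q \<noteq> 0" "poly (slice_w Q w) z = 0"
  obtains F where "F \<in> prime_factors Q" "poly (slice_w F w) z = 0"
proof -
  have prod: "poly (slice_w (prod_mset M) w) z = 0 \<Longrightarrow> \<exists>F\<in>#M. poly (slice_w F w) z = 0" for M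
    by (induction M) auto
  obtain u where "u \<noteq> 0" "Q = [:[:u:]:] * prod_mset (prime_factorization Q)"
    using prime_factorization_up_to_constant[OF assms(1)] .
  then have "poly (slice_w Q w) z = u * poly (slice_w (prod_mset (prime_factorization Q)) w) z"
    by (metis poly_const_conv poly_mult)
  then have "poly (slice_w (prod_mset (prime_factorization Q)) w) z = 0"
    using assms(2) \<open>u \<noteq> 0\<close> by simp
  with prod that show thesis by blast
qed

lemma rsquarefree_same_roots_proportional:
  fixes p q :: "complex poly"
  assumes "rsquarefree p" "rsquarefree q" "{x. poly p x = 0} = {x. poly q x = 0}"
  obtains c where "p = Polynomial.smult c q"
proof -
  have "lead_coeff q \<noteq> 0" using assms(2) by (auto simp: rsquarefree_def)
  then have "p = Polynomial.smult (lead_coeff p / lead_coeff q) q"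
    using complex_poly_decompose_rsquarefree[OF assms(1)]
      complex_poly_decompose_rsquarefree[OF assms(2)] assms(3)
    by (metis (no_types, lifting) nonzero_eq_divide_eq smult_smult)
  then show thesis by (rule that)
qed

lemma rsquarefree_card_roots:
  fixes p :: "complex poly"
  assumes "rsquarefree p"
  shows "card {x. poly p x = 0} = degree p"
proof -
  have p0: "p \<noteq> 0" using assms by (simp add: rsquarefree_def)
  have "degree p = degree (\<Prod>z|poly p z = 0. [:-z, 1:])"
    using complex_poly_decompose_rsquarefree[OF assms] p0 by (metis degree_smult_eq leading_coeff_0_iff)
  also have "\<dots> = card {x. poly p x = 0}" by (simp add: degree_prod_sum_eq)
  finally show ?thesis ..
qed

text \<open>
  A polynomial is determined by its coefficient at \<open>n\<close> and its values at \<open>n\<close> points if its degree is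
  at most \<open>n\<close>; here \<open>n\<close> is the degree of \<open>p\<close>, which is also its number of roots.
\<close>

lemma vanishing_on_roots_proportional:
  fixes p g :: "complex poly"
  assumes p: "rsquarefree p" and "degree g \<le> degree p" and "\<And>x. poly p x = 0 \<Longrightarrow> poly g x = 0"
  obtains c where "g = Polynomial.smult c p"
proof -
  have "lead_coeff p \<noteq> 0" using p by (simp add: rsquarefree_def)
  then have "g = Polynomial.smult (coeff g (degree p) / lead_coeff p) p"
    by (intro poly_eqI_degree_lead_coeff[where n = "degree p" and A = "{x. poly p x = 0}"])
      (use assms in \<open>auto simp: rsquarefree_card_roots\<close>)
  then show thesis by (rule that)
qed

lemma generic_simple_zeros:
  assumes Q: "polynomial_correspondence dw dz Q"
    and sqf: "\<And>F. F \<in> prime_factors Q \<Longrightarrow> multiplicity F Q = 1"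
  obtains E where "finite E"
    and "\<And>z w. z \<notin> E \<Longrightarrow> poly (slice_w Q w) z = 0 \<Longrightarrow> Polynomial.order z (slice_w Q w) = 1"
    and "\<And>z. z \<notin> E \<Longrightarrow> rsquarefree (slice_z Q z)"
proof -
  note sl = polynomial_correspondence_slices[OF Q]
  obtain E where E: "finite E" "\<And>F z w. F \<in> prime_factors Q \<Longrightarrow> z \<notin> E \<Longrightarrow> poly (slice_w F w) z = 0 \<Longrightarrow>
           Polynomial.order z (slice_w Q w) = multiplicity F Q \<and>
           Polynomial.order w (slice_z Q z) = multiplicity F Q"
    using generic_orders[OF Q] by metis
  have *: "Polynomial.order z (slice_w Q w) = 1 \<and> Polynomial.order w (slice_z Q z) = 1"
    if z: "z \<notin> E" and 0: "poly (slice_w Q w) z = 0" for z w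
  proof -
    obtain F where F: "F \<in> prime_factors Q" "poly (slice_w F w) z = 0"
      using zero_imp_prime_factor_zero[OF sl(7) 0] .
    show ?thesis using E(2)[OF F(1) z F(2)] sqf[OF F(1)] by simp
  qed
  have "rsquarefree (slice_z Q z)" if z: "z \<notin> E" for z
    unfolding rsquarefree_def
  proof (intro conjI allI sl(5))
    fix w
    show "Polynomial.order w (slice_z Q z) = 0 \<or> Polynomial.order w (slice_z Q z) = 1"
      using *[OF z, of w] by (metis order_root poly_slice_z)
  qed
  with E(1) * that show thesis by blast
qed

text \<open>
  The two points lie in a common fibre, so restrictivity makes every root of one slice a root of the
  other: if \<open>w'\<close> is related to \<open>z\<^sub>1\<close>, then \<open>w'\<close> and \<open>w\<close> have the same list, and this list contains \<open>z\<^sub>2\<close>.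
\<close>

lemma generic_slices_z_proportional:
  assumes Q: "restrictive_correspondence dw dz Q"
    and sq: "rsquarefree (slice_z Q z1)" "rsquarefree (slice_z Q z2)"
    and w: "poly (slice_w Q w) z1 = 0" "poly (slice_w Q w) z2 = 0"
  obtains c where "slice_z Q z1 = Polynomial.smult c (slice_z Q z2)"
proof -
  note sl = polynomial_correspondence_slices[OF conjunct1[OF Q[unfolded restrictive_correspondence_def]]]
  have sub: "poly (slice_w Q w') b = 0" if "poly (slice_w Q w) a = 0" "poly (slice_w Q w) b = 0"
    "poly (slice_w Q w') a = 0" for a b w'
  proof -
    have "Polynomial.order b (slice_w Q w) = Polynomial.order b (slice_w Q w')"
      by (rule restrictive_order_eq[OF Q that(1,3)])
    then show ?thesis using that(2) sl(6) by (metis order_root)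
  qed
  have roots: "{x. poly (slice_z Q z1) x = 0} = {x. poly (slice_z Q z2) x = 0}"
    unfolding poly_slice_z using sub[OF w] sub[OF w(2,1)] by blast
  obtain c where "slice_z Q z1 = Polynomial.smult c (slice_z Q z2)"
    using rsquarefree_same_roots_proportional[OF sq roots] .
  then show thesis by (rule that)
qed

text \<open>
  The exceptional set removes the \<open>w\<close> where the slice drops in degree, has a root over which slices are
  not squarefree, or shares a root with \<open>A\<close>. For the other \<open>w\<close>, with \<open>q\<close> the slice at one root of
  \<open>Q(\<cdot>, w)\<close>, the combination \<open>q(w\<^sub>2) A - q(w\<^sub>1) B\<close> vanishes at all roots, since the slices at the other
  roots are proportional to \<open>q\<close>.
\<close>

lemma generic_slice_w_in_span:
  assumes Q: "restrictive_correspondence dw dz Q"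
    and sqf: "\<And>F. F \<in> prime_factors Q \<Longrightarrow> multiplicity F Q = 1"
    and w1: "slice_w Q w1 = A" and w2: "slice_w Q w2 = B"
  obtains N where "finite N"
    and "\<And>w. w \<notin> N \<Longrightarrow> independent_pair A B \<Longrightarrow>
           \<exists>a b. slice_w Q w = Polynomial.smult a A + Polynomial.smult b B"
proof -
  have pc: "polynomial_correspondence dw dz Q" using Q by (simp add: restrictive_correspondence_def)
  note sl = polynomial_correspondence_slices[OF pc]
  obtain E where E: "finite E"
    "\<And>z w. z \<notin> E \<Longrightarrow> poly (slice_w Q w) z = 0 \<Longrightarrow> Polynomial.order z (slice_w Q w) = 1"
    "\<And>z. z \<notin> E \<Longrightarrow> rsquarefree (slice_z Q z)"
    using generic_simple_zeros[OF pc sqf] by metis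
  define E' where "E' = E \<union> {z. poly A z = 0}"
  have "A \<noteq> 0" using sl(6) w1 by auto
  then have E': "finite E'" unfolding E'_def using E(1) by (simp add: poly_roots_finite)
  define N where "N = {w. degree (slice_w Q w) \<noteq> degree_z Q} \<union> (\<Union>z\<in>E'. {w. poly (slice_z Q z) w = 0})"
  have N: "finite N" unfolding N_def
    by (intro finite_UnI finite_UN_I E' finite_degree_slice_w_drop poly_roots_finite sl)
  have "\<exists>a b. slice_w Q w = Polynomial.smult a A + Polynomial.smult b B"
    if w: "w \<notin> N" and ind: "independent_pair A B" for w
  proof -
    let ?u = "slice_w Q w"
    have deg: "degree ?u = dw" using w sl(1) unfolding N_def by auto
    have notE: "z \<notin> E'" if "poly ?u z = 0" for z
      using w that unfolding N_def by (auto simp: poly_slice_z)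
    have u: "rsquarefree ?u"
      unfolding rsquarefree_def
    proof (intro conjI allI sl(6))
      fix z
      show "Polynomial.order z ?u = 0 \<or> Polynomial.order z ?u = 1"
        using E(2)[of z w] notE[of z] unfolding E'_def
        by (cases "poly ?u z = 0") (auto simp: order_root)
    qed
    obtain z1 where z1: "poly ?u z1 = 0"
      using complex_root_exists[of ?u] deg sl(3) by auto
    let ?q = "slice_z Q z1"
    \<comment> \<open>The combination is chosen to vanish at \<open>z1\<close>; proportionality carries this to every root.\<close>
    define g where "g = Polynomial.smult (poly ?q w2) A - Polynomial.smult (poly ?q w1) B"
    have "poly g z = 0" if z: "poly ?u z = 0" for z
    proof -
      have "rsquarefree (slice_z Q z)" "rsquarefree ?q"
        using notE[OF z] notE[OF z1] E(3) unfolding E'_def by auto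
      then obtain c where "slice_z Q z = Polynomial.smult c ?q"
        using generic_slices_z_proportional[OF Q _ _ z z1] by metis
      then have "poly A z = c * poly ?q w1" "poly B z = c * poly ?q w2"
        unfolding w1[symmetric] w2[symmetric] poly_slice_z[symmetric] by simp_all
      then show ?thesis by (simp add: g_def)
    qed
    moreover have "degree g \<le> degree ?u"
      unfolding g_def deg sl(1)[symmetric] w1[symmetric] w2[symmetric]
      by (intro degree_diff_le order.trans[OF degree_smult_le] degree_slice_w_le)
    ultimately obtain k where k: "g = Polynomial.smult k ?u"
      using vanishing_on_roots_proportional[OF u] by metis
    \<comment> \<open>Here \<open>w\<close> is used not to share a root with \<open>A\<close>: otherwise \<open>g\<close> itself might be zero.\<close>
    have "poly ?q w1 \<noteq> 0"
      using notE[OF z1] unfolding E'_def w1[symmetric] by (simp add: poly_slice_z)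
    then have "k \<noteq> 0"
      using ind[unfolded independent_pair_def, rule_format, of "poly ?q w2" "- poly ?q w1"] k
      by (auto simp: g_def)
    then have "?u = Polynomial.smult (1 / k) g" using k by simp
    also have "\<dots> = Polynomial.smult (poly ?q w2 / k) A + Polynomial.smult (- poly ?q w1 / k) B"
      by (simp add: g_def smult_diff_right)
    finally show ?thesis by blast
  qed
  with N that show thesis by blast
qed

text \<open>
  Choose a root \<open>z\<^sub>1\<close> of one slice and a second slice that does not vanish at \<open>z\<^sub>1\<close>; if there were none,
  then \<open>Q\<close> would vanish identically over \<open>z\<^sub>1\<close>.
\<close>

lemma independent_slices_w:
  assumes Q: "polynomial_correspondence dw dz Q"
  obtains w1 w2 where "independent_pair (slice_w Q w1) (slice_w Q w2)"
proof -
  note sl = polynomial_correspondence_slices[OF Q]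
  obtain w1 where w1: "w1 \<notin> {w. degree (slice_w Q w) \<noteq> degree_z Q}"
    using finite_avoid[OF finite_degree_slice_w_drop[OF sl(7)]] .
  then obtain z1 where z1: "poly (slice_w Q w1) z1 = 0"
    using complex_root_exists[of "slice_w Q w1"] sl(1,3) by auto
  obtain w2 where w2: "poly (slice_z Q z1) w2 \<noteq> 0" using sl(5)[of z1] by (meson poly_all_0_iff_0)
  have "independent_pair (slice_w Q w1) (slice_w Q w2)"
    unfolding independent_pair_def
  proof (intro allI impI)
    fix a b assume eq: "Polynomial.smult a (slice_w Q w1) + Polynomial.smult b (slice_w Q w2) = 0"
    from arg_cong[OF eq, of "\<lambda>p. poly p z1"] have "b = 0"
      using z1 w2 by (simp add: poly_slice_z)
    then show "a = 0 \<and> b = 0" using eq sl(6)[of w1] by simp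
  qed
  then show thesis by (rule that)
qed

lemma independent_pair_minor:
  assumes "independent_pair A B"
  obtains s t where "poly A s * poly B t - poly A t * poly B s \<noteq> 0"
proof -
  have "B \<noteq> 0" using assms[unfolded independent_pair_def, rule_format, of 0 1] by auto
  then obtain t where t: "poly B t \<noteq> 0" by (meson poly_all_0_iff_0)
  then have "Polynomial.smult (poly B t) A + Polynomial.smult (- poly A t) B \<noteq> 0"
    using assms unfolding independent_pair_def by blast
  then obtain s where "poly (Polynomial.smult (poly B t) A + Polynomial.smult (- poly A t) B) s \<noteq> 0"
    by (meson poly_all_0_iff_0)
  then show thesis by (intro that[of s t]) (simp add: mult_ac)
qed

text \<open>
  The coordinates of a generic slice with respect to \<open>A\<close> and \<open>B\<close> are recovered from its values at
  two points \<open>s\<close>, \<open>t\<close> by Cramer's rule, hence they are polynomials in \<open>w\<close>. An identity of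
  polynomials that holds for generic \<open>w\<close> holds everywhere.
\<close>

lemma squarefree_restrictive_separates:
  assumes Q: "restrictive_correspondence dw dz Q"
    and sqf: "\<And>F. F \<in> prime_factors Q \<Longrightarrow> multiplicity F Q = 1"
  obtains A B C D where "independent_pair A B"
    and "\<And>z w. poly (slice_w Q w) z = poly A z * poly C w + poly B z * poly D w"
proof -
  have pc: "polynomial_correspondence dw dz Q" using Q by (simp add: restrictive_correspondence_def)
  obtain w1 w2 where ind': "independent_pair (slice_w Q w1) (slice_w Q w2)"
    using independent_slices_w[OF pc] .
  define A B where "A = slice_w Q w1" and "B = slice_w Q w2"
  have ind: "independent_pair A B" using ind' by (simp add: A_def B_def)
  obtain N where N: "finite N"
    "\<And>w. w \<notin> N \<Longrightarrow> \<exists>a b. slice_w Q w = Polynomial.smult a A + Polynomial.smult b B"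
    using generic_slice_w_in_span[OF Q sqf A_def[symmetric] B_def[symmetric]] ind by metis
  obtain s t where st: "poly A s * poly B t - poly A t * poly B s \<noteq> 0"
    using independent_pair_minor[OF ind] .
  define \<Delta> where "\<Delta> = poly A s * poly B t - poly A t * poly B s"
  define C where "C = Polynomial.smult (1 / \<Delta>)
    (Polynomial.smult (poly B t) (slice_z Q s) - Polynomial.smult (poly B s) (slice_z Q t))"
  define D where "D = Polynomial.smult (1 / \<Delta>)
    (Polynomial.smult (poly A s) (slice_z Q t) - Polynomial.smult (poly A t) (slice_z Q s))"
  have \<Delta>: "\<Delta> \<noteq> 0" using st by (simp add: \<Delta>_def)
  have generic: "poly (slice_w Q w) z = poly A z * poly C w + poly B z * poly D w" if w: "w \<notin> N" for z w
  proof -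
    obtain a b where ab: "slice_w Q w = Polynomial.smult a A + Polynomial.smult b B"
      using N(2)[OF w] by blast
    have q: "poly (slice_z Q x) w = a * poly A x + b * poly B x" for x
      by (simp add: poly_slice_z ab)
    have "poly B t * poly (slice_z Q s) w - poly B s * poly (slice_z Q t) w = a * \<Delta>"
      by (simp add: q \<Delta>_def algebra_simps)
    then have "poly C w = a" unfolding C_def using \<Delta> by simp
    moreover have "poly A s * poly (slice_z Q t) w - poly A t * poly (slice_z Q s) w = b * \<Delta>"
      by (simp add: q \<Delta>_def algebra_simps)
    then have "poly D w = b" unfolding D_def using \<Delta> by simp
    ultimately show ?thesis by (simp add: ab)
  qed
  have "poly (slice_w Q w) z = poly A z * poly C w + poly B z * poly D w" for z w
  proof -
    let ?R = "Polynomial.smult (poly A z) C + Polynomial.smult (poly B z) D"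
    have "slice_z Q z - ?R = 0"
    proof (rule ccontr)
      assume "slice_z Q z - ?R \<noteq> 0"
      then have "finite ({x. poly (slice_z Q z - ?R) x = 0} \<union> N)"
        using N(1) by (simp add: poly_roots_finite del: poly_diff)
      then obtain x where "x \<notin> {x. poly (slice_z Q z - ?R) x = 0} \<union> N" by (rule finite_avoid)
      then show False using generic[of x z] by (simp add: poly_slice_z)
    qed
    then have "poly (slice_z Q z) w = poly ?R w" by simp
    then show ?thesis by (simp add: poly_slice_z)
  qed
  with ind that show thesis by blast
qed

text \<open>
  If \<open>C\<close> and \<open>D\<close> were multiples of one polynomial \<open>H\<close>, then \<open>Q\<close> would be a product of \<open>H(w)\<close> with a
  polynomial in \<open>z\<close>, and a root of \<open>H\<close> would give a vanishing slice.
\<close>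

lemma separated_second_factors_independent:
  assumes Q: "polynomial_correspondence dw dz Q"
    and sep: "\<And>z w. poly (slice_w Q w) z = poly A z * poly C w + poly B z * poly D w"
  shows "independent_pair C D"
  unfolding independent_pair_def
proof (intro allI impI, rule ccontr)
  fix a b assume eq: "Polynomial.smult a C + Polynomial.smult b D = 0" and ne: "\<not> (a = 0 \<and> b = 0)"
  note sl = polynomial_correspondence_slices[OF Q]
  obtain H where H: "C = Polynomial.smult (- b) H" "D = Polynomial.smult a H"
  proof (cases "a = 0")
    case True
    with ne eq show thesis by (intro that[of "Polynomial.smult (- 1 / b) C"]) auto
  next
    case False
    have "Polynomial.smult a C = Polynomial.smult (- b) D" using eq by (simp add: add_eq_0_iff)
    then have "Polynomial.smult (1 / a) (Polynomial.smult a C) = Polynomial.smult (1 / a) (Polynomial.smult (- b) D)"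
      by simp
    with False show thesis by (intro that[of "Polynomial.smult (1 / a) D"]) (auto simp: mult_ac)
  qed
  have val: "poly (slice_w Q w) z = (a * poly B z - b * poly A z) * poly H w" for z w
    by (simp add: sep H algebra_simps)
  obtain z where "z \<notin> {z. degree (slice_z Q z) \<noteq> degree Q}"
    using finite_avoid[OF finite_degree_slice_z_drop[OF sl(7)]] .
  moreover have "slice_z Q z = Polynomial.smult (a * poly B z - b * poly A z) H"
    by (rule poly_ext) (simp add: poly_slice_z val)
  ultimately have "degree H > 0" using sl(2,4) by (auto split: if_splits)
  then obtain r where "poly H r = 0" by (rule complex_root_exists)
  then have "slice_w Q r = 0" by (intro poly_ext) (simp add: val)
  with sl(6) show False by blast
qed

section \<open>The rank of the coefficient matrix\<close>

lemma (in vec_space) rank_le_sum_of_products: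
  fixes f g :: "nat \<Rightarrow> nat \<Rightarrow> 'a"
  assumes "M \<in> carrier_mat n nc"
    and "\<And>r c. r < n \<Longrightarrow> c < nc \<Longrightarrow> M $$ (r, c) = (\<Sum>i<k. f i r * g i c)"
  shows "rank M \<le> k"
  using assms
proof (induction k arbitrary: M)
  case 0
  then have "M = 0\<^sub>m n nc" by (intro eq_matI) auto
  then show ?case by (simp add: rank_0I)
next
  case (Suc k)
  let ?M = "mat n nc (\<lambda>(r, c). \<Sum>i<k. f i r * g i c)" and ?N = "mat n nc (\<lambda>(r, c). f k r * g k c)"
  have "M = ?M + ?N" using Suc.prems by (intro eq_matI) auto
  then have "rank M \<le> rank ?M + rank ?N" using rank_subadditive[of ?M nc ?N] by simp
  moreover have "rank ?M \<le> k" by (rule Suc.IH) auto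
  moreover have "rank ?N \<le> 1" by (rule rank_le_1_product_entries[where f = "f k" and g = "g k"]) auto
  ultimately show ?case by simp
qed

text \<open>
  The columns of \<open>M X\<close> lie in the column space of \<open>M\<close>, and injectivity makes them linearly independent.
\<close>

lemma (in vec_space) rank_ge_injective_product:
  assumes M: "M \<in> carrier_mat n nc" and X: "X \<in> carrier_mat nc k"
    and inj: "\<And>v. v \<in> carrier_vec k \<Longrightarrow> (M * X) *\<^sub>v v = 0\<^sub>v n \<Longrightarrow> v = 0\<^sub>v k"
  shows "k \<le> rank M"
proof -
  let ?Y = "M * X"
  have Y: "?Y \<in> carrier_mat n k" using M X by simp
  have dist: "distinct (cols ?Y)"
    unfolding distinct_conv_nth
  proof (intro allI impI notI)
    fix i j assume ij: "i < length (cols ?Y)" "j < length (cols ?Y)" "i \<noteq> j" "cols ?Y ! i = cols ?Y ! j"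
    then have ij': "i < k" "j < k" "col ?Y i = col ?Y j" using Y by auto
    let ?v = "unit_vec k i - unit_vec k j :: 'a vec"
    have unit: "?Y *\<^sub>v unit_vec k m = col ?Y m" if "m < k" for m
      using Y that by (intro eq_vecI) (auto simp: scalar_prod_right_unit)
    have "?Y *\<^sub>v ?v = ?Y *\<^sub>v unit_vec k i - ?Y *\<^sub>v unit_vec k j"
      using Y by (simp add: mult_minus_distrib_mat_vec)
    also have "\<dots> = 0\<^sub>v n" using Y ij' by (simp add: unit)
    finally have "?v = 0\<^sub>v k" by (intro inj) auto
    then have "?v $ i = 0" using ij' by simp
    then show False using ij' ij(3) by simp
  qed
  have li: "lin_indpt (set (cols ?Y))"
    using lin_depE[OF Y _ dist] inj by metis
  have car: "set (cols M) \<subseteq> carrier_vec n" using cols_dim[of M] M by simp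
  have sub: "set (cols ?Y) \<subseteq> span (set (cols M))"
  proof
    fix y assume "y \<in> set (cols ?Y)"
    then obtain j where j: "j < k" "y = col ?Y j" using Y
      by (metis carrier_matD(2) cols_length cols_nth in_set_conv_nth)
    have "y = M *\<^sub>v col X j" unfolding j(2) by (rule col_mult2[OF M X j(1)])
    moreover have "y \<in> carrier_vec n" unfolding j(2) using M by (simp add: carrier_vecI)
    moreover have "col X j \<in> carrier_vec nc" using X by (simp add: carrier_vecI)
    ultimately have "y \<in> col_space M" using M by (auto simp: col_space_eq[OF M])
    then show "y \<in> span (set (cols M))" by (simp add: col_space_def)
  qed
  have sm: "submodule class_ring (span (set (cols M))) V" using car by (simp add: span_is_submodule)
  have vs: "vectorspace class_ring (span_vs (set (cols M)))"
    using span_is_subspace[THEN subspace_is_vs] car by auto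
  have "\<not> LinearCombinations.module.lin_dep class_ring (span_vs (set (cols M))) (set (cols ?Y))"
    using span_li_not_depend(2)[OF sub sm] li by simp
  then have "card (set (cols ?Y)) \<le> vectorspace.dim class_ring (span_vs (set (cols M)))"
    by (intro vectorspace.li_le_dim(2)[OF vs fin_dim_span_cols[OF M]]) (use sub in auto)
  moreover have "card (set (cols ?Y)) = k" using distinct_card[OF dist] X by simp
  ultimately show ?thesis by (simp add: rank_def)
qed

text \<open>
  If \<open>A / B\<close> took only finitely many values \<open>r\<close>, then the roots of \<open>B\<close> and of the nonzero polynomials
  \<open>A - r B\<close> would cover the plane.
\<close>

lemma independent_pair_infinite_ratios:
  assumes "independent_pair A B"
  shows "infinite ((\<lambda>z. poly A z / poly B z) ` {z. poly B z \<noteq> 0})"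
proof
  let ?R = "(\<lambda>z. poly A z / poly B z) ` {z. poly B z \<noteq> 0}"
  assume fin: "finite ?R"
  have "B \<noteq> 0" using assms[unfolded independent_pair_def, rule_format, of 0 1] by auto
  moreover have "A - Polynomial.smult r B \<noteq> 0" for r
    using assms[unfolded independent_pair_def, rule_format, of 1 "- r"] by auto
  ultimately have "finite ({z. poly B z = 0} \<union> (\<Union>r\<in>?R. {z. poly (A - Polynomial.smult r B) z = 0}))"
    using fin by (intro finite_UnI finite_UN_I poly_roots_finite)
  moreover have "UNIV \<subseteq> {z. poly B z = 0} \<union> (\<Union>r\<in>?R. {z. poly (A - Polynomial.smult r B) z = 0})"
    by (auto simp: field_simps)
  ultimately have "finite (UNIV :: complex set)" by (rule finite_subset[rotated])
  then show False by (simp add: infinite_UNIV_char_0)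
qed

text \<open>
  This is the injectivity of a transposed Vandermonde matrix: combining the hypotheses with the
  coefficients of the polynomial that vanishes at all nodes except \<open>s m\<close> isolates \<open>u m\<close>.
\<close>

lemma vanishing_power_sums:
  fixes s u :: "nat \<Rightarrow> complex"
  assumes inj: "inj_on s {..d}" and sum: "\<And>i. i \<le> d \<Longrightarrow> (\<Sum>l\<le>d. u l * s l ^ i) = 0" and m: "m \<le> d"
  shows "u m = 0"
proof -
  define g where "g = (\<Prod>l\<in>{..d} - {m}. [:- s l, 1:])"
  have deg: "degree g = d" using m by (simp add: g_def degree_prod_sum_eq)
  have "(\<Sum>l\<le>d. u l * poly g (s l)) = (\<Sum>l\<le>d. \<Sum>i\<le>d. coeff g i * (u l * s l ^ i))"
    by (simp add: poly_altdef deg sum_distrib_left mult_ac)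
  also have "\<dots> = (\<Sum>i\<le>d. coeff g i * (\<Sum>l\<le>d. u l * s l ^ i))"
    by (subst sum.swap) (simp add: sum_distrib_left)
  also have "\<dots> = 0" using sum by simp
  finally have "(\<Sum>l\<le>d. u l * poly g (s l)) = 0" .
  moreover have "(\<Sum>l\<le>d. u l * poly g (s l)) = u m * poly g (s m)"
  proof (rule sum.remove[THEN trans])
    have "poly g (s l) = 0" if "l \<in> {..d} - {m}" for l
      using that by (auto simp: g_def poly_prod)
    then show "u m * poly g (s m) + (\<Sum>l\<in>{..d} - {m}. u l * poly g (s l)) = u m * poly g (s m)"
      by (simp add: sum.neutral)
  qed (use m in auto)
  moreover have "poly g (s m) \<noteq> 0"
    using inj m by (auto simp: g_def poly_prod inj_on_def)
  ultimately show ?thesis by (metis mult_eq_0_iff)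
qed

text \<open>
  Dividing by \<open>B(z)\<^sup>d\<close> turns the relation into \<open>\<Sum>l. v\<^sub>l (t C(x\<^sub>l) + D(x\<^sub>l))\<^sup>d = 0\<close>, valid for the infinitely
  many values \<open>t = A(z) / B(z)\<close>, hence as an identity in \<open>t\<close>. Its coefficients are, up to binomial
  factors, power sums with the nodes \<open>C(x\<^sub>l) / D(x\<^sub>l)\<close>.
\<close>

lemma separated_power_samples_independent:
  assumes A: "independent_pair A B"
    and inj: "inj_on (\<lambda>l. poly C (x l) / poly D (x l)) {..d}" and D: "\<And>l. l \<le> d \<Longrightarrow> poly D (x l) \<noteq> 0"
    and zero: "\<And>z. (\<Sum>l\<le>d. v l * (poly A z * poly C (x l) + poly B z * poly D (x l)) ^ d) = 0"
    and m: "m \<le> d"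
  shows "v m = 0"
proof -
  define R where "R = (\<Sum>l\<le>d. Polynomial.smult (v l) ([:poly D (x l), poly C (x l):] ^ d))"
  have "poly R (poly A z / poly B z) = 0" if "poly B z \<noteq> 0" for z
  proof -
    have cancel: "(poly D (x l) + poly A z / poly B z * poly C (x l)) * poly B z
        = poly A z * poly C (x l) + poly B z * poly D (x l)" for l
      using that by (simp add: distrib_left mult.commute[of _ "poly B z"])
    have "poly R (poly A z / poly B z) * poly B z ^ d
        = (\<Sum>l\<le>d. v l * ((poly D (x l) + poly A z / poly B z * poly C (x l)) * poly B z) ^ d)"
      by (simp add: R_def poly_sum sum_distrib_left power_mult_distrib mult_ac)
    also have "\<dots> = (\<Sum>l\<le>d. v l * (poly A z * poly C (x l) + poly B z * poly D (x l)) ^ d)"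
      by (simp only: cancel)
    finally show ?thesis using zero[of z] that by simp
  qed
  then have "(\<lambda>z. poly A z / poly B z) ` {z. poly B z \<noteq> 0} \<subseteq> {t. poly R t = 0}" by auto
  then have "R = 0" using independent_pair_infinite_ratios[OF A] poly_roots_finite finite_subset by metis
  have "(\<Sum>l\<le>d. (v l * poly D (x l) ^ d) * (poly C (x l) / poly D (x l)) ^ i) = 0" if i: "i \<le> d" for i
  proof -
    have "of_nat (d choose i) * (\<Sum>l\<le>d. (v l * poly D (x l) ^ d) * (poly C (x l) / poly D (x l)) ^ i)
        = (\<Sum>l\<le>d. v l * (of_nat (d choose i) * poly C (x l) ^ i * poly D (x l) ^ (d - i)))"
      unfolding sum_distrib_left
    proof (intro sum.cong refl)
      fix l assume "l \<in> {..d}"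
      then have "poly D (x l) \<noteq> 0" using D by simp
      then have "poly D (x l) ^ d * (poly C (x l) / poly D (x l)) ^ i = poly C (x l) ^ i * poly D (x l) ^ (d - i)"
        using i by (simp add: power_divide power_diff)
      then show "of_nat (d choose i) * (v l * poly D (x l) ^ d * (poly C (x l) / poly D (x l)) ^ i) =
           v l * (of_nat (d choose i) * poly C (x l) ^ i * poly D (x l) ^ (d - i))"
        by (simp add: mult_ac)
    qed
    also have "\<dots> = coeff R i"
      by (simp add: R_def coeff_sum coeff_linear_poly_power[OF i])
    finally show ?thesis using \<open>R = 0\<close> i by simp
  qed
  from vanishing_power_sums[OF inj this m] show ?thesis using D[OF m] by simp
qed

lemma separated_power_coeff:
  assumes sep: "\<And>z w. poly (slice_w Q w) z = poly A z * poly C w + poly B z * poly D w"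
  shows "coeff (coeff (Q ^ d) k) j =
    (\<Sum>i<d + 1. coeff (Polynomial.smult (of_nat (d choose i)) (A ^ i * B ^ (d - i))) j * coeff (C ^ i * D ^ (d - i)) k)"
proof -
  have sl: "slice_w (Q ^ d) w = (\<Sum>i\<le>d. Polynomial.smult (poly (C ^ i * D ^ (d - i)) w)
      (Polynomial.smult (of_nat (d choose i)) (A ^ i * B ^ (d - i))))" for w
  proof (rule poly_ext)
    fix z
    show "poly (slice_w (Q ^ d) w) z = poly (\<Sum>i\<le>d. Polynomial.smult (poly (C ^ i * D ^ (d - i)) w)
      (Polynomial.smult (of_nat (d choose i)) (A ^ i * B ^ (d - i)))) z"
      by (simp add: sep binomial_ring poly_sum power_mult_distrib mult_ac)
  qed
  have "map_poly (\<lambda>p. coeff p j) (Q ^ d) =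
      (\<Sum>i\<le>d. Polynomial.smult (coeff (Polynomial.smult (of_nat (d choose i)) (A ^ i * B ^ (d - i))) j) (C ^ i * D ^ (d - i)))"
    by (rule poly_ext, simp only: coeff_slice_w[symmetric] sl) (simp add: coeff_sum poly_sum mult_ac)
  from arg_cong[OF this, of "\<lambda>p. coeff p k"] show ?thesis
    by (simp add: coeff_map_poly coeff_sum lessThan_Suc_atMost)
qed

text \<open>
  Combining the columns with powers of \<open>x\<close> evaluates \<open>P\<close> at \<open>w = x\<close>, so the coefficient vectors of
  slices lie in the column space. The exponents run backwards because the columns of the matrix are
  ordered by decreasing powers of \<open>w\<close>.
\<close>

lemma corr_matrix_mult_vandermonde:
  assumes "degree P \<le> dz"
  shows "corr_matrix dw dz P * mat (dz + 1) k (\<lambda>(c, l). x l ^ (dz - c))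
    = mat (dw + 1) k (\<lambda>(r, l). coeff (slice_w P (x l)) (dw - r))"
proof (rule eq_matI, goal_cases)
  case (1 r l)
  then have r: "r < dw + 1" and l: "l < k" by auto
  let ?p = "map_poly (\<lambda>p. coeff p (dw - r)) P"
  have "degree ?p \<le> dz"
    using assms by (intro degree_le) (auto simp: coeff_map_poly coeff_eq_0)
  have "(corr_matrix dw dz P * mat (dz + 1) k (\<lambda>(c, l). x l ^ (dz - c))) $$ (r, l)
      = (\<Sum>c<dz + 1. coeff ?p (dz - c) * x l ^ (dz - c))"
    using r l by (simp add: corr_matrix_def scalar_prod_def coeff_map_poly lessThan_atLeast0 del: sum.lessThan_Suc sum.op_ivl_Suc)
  also have "\<dots> = (\<Sum>c\<le>dz. coeff ?p c * x l ^ c)"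
    by (simp only: Suc_eq_plus1[symmetric] lessThan_Suc_atMost sum.nat_diff_reindex[of "\<lambda>c. coeff ?p c * x l ^ c" "Suc dz", simplified])
      (rule sum.reindex_bij_witness[of _ "\<lambda>c. dz - c" "\<lambda>c. dz - c"], auto)
  also have "\<dots> = poly ?p (x l)"
    unfolding poly_altdef using \<open>degree ?p \<le> dz\<close>
    by (intro sum.mono_neutral_right) (auto simp: coeff_eq_0)
  finally show ?case using r l by (simp add: coeff_slice_w)
qed (auto simp: corr_matrix_def)

lemma rank_separated_power:
  assumes AB: "independent_pair A B" and CD: "independent_pair C D"
    and sep: "\<And>z w. poly (slice_w Q w) z = poly A z * poly C w + poly B z * poly D w"
    and dw: "degree_z (Q ^ d) \<le> dw" and dz: "degree (Q ^ d) \<le> dz"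
  shows "vec_space.rank (dw + 1) (corr_matrix dw dz (Q ^ d)) = d + 1"
proof (rule antisym)
  let ?M = "corr_matrix dw dz (Q ^ d)"
  have M: "?M \<in> carrier_mat (dw + 1) (dz + 1)" by (simp add: corr_matrix_def)
  show "vec_space.rank (dw + 1) ?M \<le> d + 1"
    by (rule vec_space.rank_le_sum_of_products[OF M, where
          f = "\<lambda>i r. coeff (Polynomial.smult (of_nat (d choose i)) (A ^ i * B ^ (d - i))) (dw - r)" and
          g = "\<lambda>i c. coeff (C ^ i * D ^ (d - i)) (dz - c)"])
      (simp add: corr_matrix_def separated_power_coeff[OF sep] del: coeff_smult sum.lessThan_Suc)
  obtain T where T: "finite T" "card T = d + 1" "T \<subseteq> (\<lambda>w. poly C w / poly D w) ` {w. poly D w \<noteq> 0}"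
    using infinite_arbitrarily_large[OF independent_pair_infinite_ratios[OF CD]] by blast
  obtain h where h: "bij_betw h {0..<d + 1} T" using ex_bij_betw_nat_finite[OF T(1)] T(2) by metis
  have "\<exists>w. poly D w \<noteq> 0 \<and> h l = poly C w / poly D w" if "l \<le> d" for l
  proof -
    have "h l \<in> T" using h that by (auto simp: bij_betw_def)
    then show ?thesis using T(3) by blast
  qed
  then obtain x where x: "\<And>l. l \<le> d \<Longrightarrow> poly D (x l) \<noteq> 0" "\<And>l. l \<le> d \<Longrightarrow> h l = poly C (x l) / poly D (x l)"
    by metis
  have inj: "inj_on (\<lambda>l. poly C (x l) / poly D (x l)) {..d}"
  proof (rule inj_onI)
    fix a b assume "a \<in> {..d}" "b \<in> {..d}" "poly C (x a) / poly D (x a) = poly C (x b) / poly D (x b)"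
    then have "h a = h b" "a \<in> {0..<d + 1}" "b \<in> {0..<d + 1}" using x(2) by auto
    then show "a = b" using h by (meson bij_betw_def inj_onD)
  qed
  let ?X = "mat (dz + 1) (d + 1) (\<lambda>(c, l). x l ^ (dz - c)) :: complex mat"
  show "d + 1 \<le> vec_space.rank (dw + 1) ?M"
  proof (rule vec_space.rank_ge_injective_product[OF M, of ?X])
    fix v :: "complex vec" assume v: "v \<in> carrier_vec (d + 1)" and 0: "?M * ?X *\<^sub>v v = 0\<^sub>v (dw + 1)"
    define p where "p = (\<Sum>l\<le>d. Polynomial.smult (v $ l) (slice_w (Q ^ d) (x l)))"
    have "coeff p j = 0" for j
    proof (cases "j \<le> dw")
      case True
      have "(?M * ?X *\<^sub>v v) $ (dw - j) = (\<Sum>l\<in>{0..<d + 1}. coeff (slice_w (Q ^ d) (x l)) j * v $ l)"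
        unfolding corr_matrix_mult_vandermonde[OF dz] using True v
        by (simp add: scalar_prod_def del: sum.op_ivl_Suc)
      also have "\<dots> = coeff p j"
        by (simp add: p_def coeff_sum mult_ac atLeast0LessThan lessThan_Suc_atMost del: sum.lessThan_Suc sum.atMost_Suc)
      finally show ?thesis unfolding 0 using True by simp
    next
      case False
      have "degree p \<le> dw" unfolding p_def
        by (intro degree_sum_le order.trans[OF degree_smult_le] order.trans[OF degree_slice_w_le dw]) auto
      then show ?thesis using False by (intro coeff_eq_0) simp
    qed
    then have "p = 0" by (simp add: poly_eq_iff)
    have "(\<Sum>l\<le>d. v $ l * (poly A z * poly C (x l) + poly B z * poly D (x l)) ^ d) = poly p z" for z
      by (simp add: p_def poly_sum sep)
    then have "v $ m = 0" if "m \<le> d" for m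
      using separated_power_samples_independent[OF AB inj x(1) _ that, of "\<lambda>l. v $ l"] \<open>p = 0\<close> by simp
    then show "v = 0\<^sub>v (d + 1)" using v by (intro eq_vecI) auto
  qed simp
qed

theorem theorem3p3:
  fixes P Q :: "complex poly poly" and dw dz dw' dz' d :: nat
  assumes "dw > 1 \<or> dz > 1"
    and "reducible_restrictive dw dz P"
    and "irreducible_restrictive dw' dz' Q"
    and "d dvd dw" and "d dvd dz"
    and "d * dw' = dw" and "d * dz' = dz"
    and "P = Q ^ d"
  shows "vec_space.rank (dw + 1) (corr_matrix dw dz P) = d + 1"
proof -
  have rc: "restrictive_correspondence dw' dz' Q"
    using assms(3) by (simp add: irreducible_restrictive_def)
  then have pc: "polynomial_correspondence dw' dz' Q"
    by (simp add: restrictive_correspondence_def)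
  note sl = polynomial_correspondence_slices[OF pc]
  obtain A B C D where AB: "independent_pair A B"
    and sep: "\<And>z w. poly (slice_w Q w) z = poly A z * poly C w + poly B z * poly D w"
    using squarefree_restrictive_separates[OF rc irreducible_restrictive_squarefree[OF assms(3)]] by metis
  have "degree_z (Q ^ d) = dw" "degree (Q ^ d) = dz"
    using sl assms(6,7) by (simp_all add: degree_z_power degree_power_eq)
  then show ?thesis
    unfolding assms(8)
    by (intro rank_separated_power[OF AB separated_second_factors_independent[OF pc sep] sep]) simp_all
qed

end
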